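(* Let $G$ be a finitely generated group which is not virtually $\mathbf{Z}$. Suppose there exists a (possibly infinite) generating set $S$ of $G$ of cardinality at least two such that every element of $S$ has infinite order and the commutativity graph $K(G,S)$ is connected. Suppose further that there exist adjacent vertices $s, s'$ of $K(G,S)$ and non-zero integers $n_s, n_{s'}$ such that $\langle s^{n_s}, (s')^{n_{s'}}\rangle$ is abelian of rank $2$. Then $G$ has one end.
   Context: Commutativity graph: let $G$ be a group and $S$ a (possibly infinite) generating set for $G$, all of whose elements have infinite order. The commutativity graph $K(G,S)$ is the simplicial graph with vertex set $S$ in which distinct vertices $s,s'$ are joined by an edge if and only if there are non-zero integers $n_s,n_{s'}$ such that the subgroup $\langle s^{n_s},(s')^{n_{s'}}\rangle$ of $G$ is abelian. Rank: the rank of a finitely generated abelian group $A$ is the rank of some (equivalently every) free abelian subgroup of finite index in $A$. One end: a finitely generated infinite group $G$ has one end if for some (equivalently every) finite generating set $T$, for every $n$ the complement in the Cayley graph ${\rm Cay}(G,T)$ of the ball of radius $n$ about the identity has exactly one unbounded connected component. *)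

theory Defs
  imports
    "HOL-Algebra.Elementary_Groups"
    "HOL-Algebra.Free_Abelian_Groups"
    "HOL-Algebra.Multiplicative_Group"
    "Graph_Theory.Digraph_Component"
begin

text \<open>Undirected graphs are represented as symmetric digraphs without parallel arcs.\<close>

definition generating_set :: "('a, 'b) monoid_scheme \<Rightarrow> 'a set \<Rightarrow> bool" where
  "generating_set G S \<longleftrightarrow> S \<subseteq> carrier G \<and> generate G S = carrier G"

definition finitely_generated :: "('a, 'b) monoid_scheme \<Rightarrow> bool" where
  "finitely_generated G \<longleftrightarrow> (\<exists>T. finite T \<and> generating_set G T)"

definition finite_index_subgroup :: "'a set \<Rightarrow> ('a, 'b) monoid_scheme \<Rightarrow> bool" where
  "finite_index_subgroup H G \<longleftrightarrow> subgroup H G \<and> finite (rcosets\<^bsub>G\<^esub> H)"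

definition virtually_Z :: "('a, 'b) monoid_scheme \<Rightarrow> bool" where
  "virtually_Z G \<longleftrightarrow> (\<exists>H. finite_index_subgroup H G \<and> G\<lparr>carrier := H\<rparr> \<cong> integer_group)"

text \<open>Only meaningful for finitely generated abelian groups, where exactly one \<open>r\<close> qualifies.\<close>

definition has_rank :: "('a, 'b) monoid_scheme \<Rightarrow> nat \<Rightarrow> bool" where
  "has_rank A r \<longleftrightarrow>
    (\<exists>H. finite_index_subgroup H A \<and> A\<lparr>carrier := H\<rparr> \<cong> free_Abelian_group {..<r})"

definition commutativity_graph :: "('a, 'b) monoid_scheme \<Rightarrow> 'a set \<Rightarrow> 'a pair_pre_digraph" where
  "commutativity_graph G S =
    \<lparr> pverts = S,
      parcs = {(s, s'). s \<in> S \<and> s' \<in> S \<and> s \<noteq> s' \<and>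
        (\<exists>(n :: int) (n' :: int). n \<noteq> 0 \<and> n' \<noteq> 0 \<and>
          comm_group (subgroup_generated G {s [^]\<^bsub>G\<^esub> n, s' [^]\<^bsub>G\<^esub> n'}))} \<rparr>"

text \<open>\<open>T\<close> need not be closed under inverses, so both directions of each edge are put in by hand;
  a loop at every vertex when \<open>\<one> \<in> T\<close> affects neither distances nor components.\<close>

definition cayley_graph :: "('a, 'b) monoid_scheme \<Rightarrow> 'a set \<Rightarrow> 'a pair_pre_digraph" where
  "cayley_graph G T =
    \<lparr> pverts = carrier G,
      parcs = {(g, h). g \<in> carrier G \<and> h \<in> carrier G \<and>
        (\<exists>t\<in>T. h = g \<otimes>\<^bsub>G\<^esub> t \<or> g = h \<otimes>\<^bsub>G\<^esub> t)} \<rparr>"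

definition cayley_ball :: "('a, 'b) monoid_scheme \<Rightarrow> 'a set \<Rightarrow> nat \<Rightarrow> 'a set" where
  "cayley_ball G T n =
    {g. \<exists>p. pre_digraph.awalk (with_proj (cayley_graph G T)) \<one>\<^bsub>G\<^esub> p g \<and> length p \<le> n}"

text \<open>In a symmetric digraph the strongly connected components are exactly the connected
  components of the underlying undirected graph.\<close>

definition ball_complement_components ::
  "('a, 'b) monoid_scheme \<Rightarrow> 'a set \<Rightarrow> nat \<Rightarrow> 'a set set" where
  "ball_complement_components G T n =
    pre_digraph.sccs_verts (with_proj (cayley_graph G T) \<restriction> (carrier G - cayley_ball G T n))"

definition cayley_unbounded :: "('a, 'b) monoid_scheme \<Rightarrow> 'a set \<Rightarrow> 'a set \<Rightarrow> bool" where
  "cayley_unbounded G T C \<longleftrightarrow> (\<forall>m. \<not> C \<subseteq> cayley_ball G T m)"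

definition one_ended :: "('a, 'b) monoid_scheme \<Rightarrow> bool" where
  "one_ended G \<longleftrightarrow> infinite (carrier G) \<and>
    (\<exists>T. finite T \<and> generating_set G T \<and>
      (\<forall>n. \<exists>!C. C \<in> ball_complement_components G T n \<and> cayley_unbounded G T C))"

end

theory Submission
  imports Defs
begin

text \<open>Let \<open>A\<close> be a component of the complement of a ball \<open>K\<close>. It is almost invariant under right
  multiplication, so along each coset \<open>x\<langle>s\<rangle>\<close> with \<open>s\<close> of infinite order, membership in \<open>A\<close> is
  eventually constant in either direction. On cosets of \<open>\<int>\<^sup>2\<close> both directions agree (\<open>\<int>\<^sup>2\<close> is
  one-ended), and connectedness of the commutativity graph spreads this common value, first to all
  \<open>s \<in> S\<close> and then to all base points \<open>x\<close>. Suppose the value is "outside \<open>A\<close>". The net flow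
  \<open>|A - A g\<^sup>-\<^sup>1| - |A g\<^sup>-\<^sup>1 - A|\<close> is a homomorphism \<open>G \<rightarrow> \<int>\<close> that vanishes on \<open>S\<close>, hence everywhere. If
  \<open>A\<close> were infinite, any \<open>g \<in> A\<close> far from \<open>\<one>\<close> would satisfy \<open>g A \<subseteq> A\<close>, and large powers of such a
  \<open>g\<close> would have non-zero flow. So every infinite component contains almost all powers of a fixed
  \<open>s\<close>, which leaves room for only one. Stallings' theorem is not needed.\<close>

section \<open>Almost invariant sets and their flow\<close>

context group
begin

text \<open>For \<open>A\<close> inside the group this is the symmetric difference of
  \<open>A\<close> and A g^-1.\<close>

definition crossing :: "'a set \<Rightarrow> 'a \<Rightarrow> 'a set" where
  "crossing A g = {h \<in> carrier G. (h \<in> A) \<noteq> (h \<otimes> g \<in> A)}"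

definition almost_invariant :: "'a set \<Rightarrow> bool" where
  "almost_invariant A \<longleftrightarrow> A \<subseteq> carrier G \<and> (\<forall>g\<in>carrier G. finite (crossing A g))"

text \<open>Every term is 1 or -1, so this stands in for |A| - |A g^-1| and makes sense for infinite
  \<open>A\<close> as long as the crossing is finite; on an infinite crossing the sum is 0 by
  convention.\<close>

definition flow :: "'a set \<Rightarrow> 'a \<Rightarrow> int" where
  "flow A g = (\<Sum>h\<in>crossing A g. of_bool (h \<in> A) - of_bool (h \<otimes> g \<in> A))"

text \<open>Here \<open>k\<close> runs over all integers, so both ends of the coset of
  \<open>s\<close> through \<open>x\<close> must have the same value \<open>c\<close>.\<close>

definition limit_along :: "'a set \<Rightarrow> 'a \<Rightarrow> 'a \<Rightarrow> bool \<Rightarrow> bool" where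
  "limit_along A x s c \<longleftrightarrow> finite {k :: int. (x \<otimes> s [^] k \<in> A) \<noteq> c}"

lemma crossing_inv:
  assumes "g \<in> carrier G"
  shows "crossing A (inv g) \<subseteq> (\<lambda>h. h \<otimes> g) ` crossing A g"
proof
  fix h assume h: "h \<in> crossing A (inv g)"
  then have "h \<in> carrier G" by (simp add: crossing_def)
  then have "h = (h \<otimes> inv g) \<otimes> g" using assms by (simp add: m_assoc)
  moreover have "h \<otimes> inv g \<in> crossing A g"
    using h assms by (auto simp: crossing_def m_assoc)
  ultimately show "h \<in> (\<lambda>h. h \<otimes> g) ` crossing A g" by blast
qed

lemma crossing_mult:
  assumes "g \<in> carrier G" "g' \<in> carrier G"
  shows "crossing A (g \<otimes> g') \<subseteq> crossing A g \<union> (\<lambda>h. h \<otimes> inv g) ` crossing A g'"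
proof
  fix h assume h: "h \<in> crossing A (g \<otimes> g')"
  then have c: "h \<in> carrier G" by (simp add: crossing_def)
  then have "h = (h \<otimes> g) \<otimes> inv g" using assms by (simp add: m_assoc)
  moreover have "h \<in> crossing A g \<or> h \<otimes> g \<in> crossing A g'"
    using h c assms by (auto simp: crossing_def m_assoc)
  ultimately show "h \<in> crossing A g \<union> (\<lambda>h. h \<otimes> inv g) ` crossing A g'" by blast
qed

text \<open>Elements with finite crossing form a subgroup, by \<open>crossing_inv\<close> and
  \<open>crossing_mult\<close>, so generators suffice.\<close>

lemma almost_invariantI:
  assumes "A \<subseteq> carrier G" "generating_set G T" "\<And>t. t \<in> T \<Longrightarrow> finite (crossing A t)"
  shows "almost_invariant A"
proof -
  have T: "T \<subseteq> carrier G" "generate G T = carrier G"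
    using assms(2) by (auto simp: generating_set_def)
  have "finite (crossing A g)" if "g \<in> generate G T" for g
    using that
  proof induction
    case one
    have "crossing A \<one> = {}" by (auto simp: crossing_def)
    then show ?case by simp
  next
    case (incl t)
    then show ?case using assms by blast
  next
    case (inv t)
    then show ?case
      using assms(3) T(1) crossing_inv by (meson finite_imageI finite_subset subsetD)
  next
    case (eng g g')
    then have "g \<in> carrier G" "g' \<in> carrier G" using T(2) by auto
    from crossing_mult[OF this] show ?case
      by (rule finite_subset) (simp add: eng.IH)
  qed
  then show ?thesis using assms(1) T(2) by (auto simp: almost_invariant_def)
qed

lemma flow_eq_sum:
  assumes "finite F" "crossing A g \<subseteq> F" "F \<subseteq> carrier G"
  shows "flow A g = (\<Sum>h\<in>F. of_bool (h \<in> A) - of_bool (h \<otimes> g \<in> A))"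
  unfolding flow_def
  by (rule sum.mono_neutral_left) (use assms in \<open>auto simp: crossing_def\<close>)

text \<open>The sum telescopes through h g between h and h g g'. One finite set \<open>F\<close>
  serves for all three flows; the flow of \<open>g'\<close> is reindexed along right multiplication
  by \<open>g\<close>.\<close>

lemma flow_mult:
  assumes A: "almost_invariant A" and g: "g \<in> carrier G" "g' \<in> carrier G"
  shows "flow A (g \<otimes> g') = flow A g + flow A g'"
proof -
  define F where "F = crossing A g \<union> (\<lambda>h. h \<otimes> inv g) ` crossing A g'"
  have F: "finite F" "F \<subseteq> carrier G"
    using A g by (auto simp: F_def almost_invariant_def crossing_def)
  have fin: "finite ((\<lambda>h. h \<otimes> g) ` F)" "(\<lambda>h. h \<otimes> g) ` F \<subseteq> carrier G"
    using F g by auto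
  have cr: "crossing A g' \<subseteq> (\<lambda>h. h \<otimes> g) ` F"
  proof
    fix h assume h: "h \<in> crossing A g'"
    then have "h = (h \<otimes> inv g) \<otimes> g" using g by (simp add: m_assoc crossing_def)
    then show "h \<in> (\<lambda>h. h \<otimes> g) ` F" using h by (auto simp: F_def)
  qed
  have inj: "inj_on (\<lambda>h. h \<otimes> g) F"
    using F g by (meson inj_onI right_cancel subsetD)
  have "flow A g' = (\<Sum>h\<in>F. of_bool (h \<otimes> g \<in> A) - of_bool (h \<otimes> g \<otimes> g' \<in> A))"
    unfolding flow_eq_sum[OF fin(1) cr fin(2)] by (simp add: sum.reindex[OF inj])
  moreover have "\<dots> = (\<Sum>h\<in>F. of_bool (h \<otimes> g \<in> A) - of_bool (h \<otimes> (g \<otimes> g') \<in> A))"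
    using F g by (intro sum.cong) (auto simp: m_assoc)
  moreover have "flow A g = (\<Sum>h\<in>F. of_bool (h \<in> A) - of_bool (h \<otimes> g \<in> A))"
    by (rule flow_eq_sum) (use F in \<open>auto simp: F_def\<close>)
  moreover have "flow A (g \<otimes> g') = (\<Sum>h\<in>F. of_bool (h \<in> A) - of_bool (h \<otimes> (g \<otimes> g') \<in> A))"
    using crossing_mult[OF g] by (intro flow_eq_sum F) (simp add: F_def)
  ultimately show ?thesis by (simp add: sum.distrib[symmetric])
qed

text \<open>For finite \<open>W\<close> the sum splits as |W| - |W g^-1|, and right multiplication
  is injective.\<close>

lemma flow_finite:
  assumes "finite W" "W \<subseteq> carrier G" "g \<in> carrier G"
  shows "flow W g = 0"
proof -
  define F where "F = W \<union> (\<lambda>h. h \<otimes> inv g) ` W"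
  have F: "finite F" "F \<subseteq> carrier G" using assms by (auto simp: F_def)
  have mem: "h \<otimes> g \<in> W \<longleftrightarrow> h \<in> (\<lambda>h. h \<otimes> inv g) ` W" if "h \<in> carrier G" for h
  proof
    assume "h \<otimes> g \<in> W"
    moreover have "h = h \<otimes> g \<otimes> inv g" using that assms by (simp add: m_assoc)
    ultimately show "h \<in> (\<lambda>h. h \<otimes> inv g) ` W" by blast
  next
    assume "h \<in> (\<lambda>h. h \<otimes> inv g) ` W"
    then show "h \<otimes> g \<in> W" using assms by (auto simp: m_assoc subset_iff)
  qed
  have "flow W g = (\<Sum>h\<in>F. of_bool (h \<in> W) - of_bool (h \<otimes> g \<in> W))"
    by (rule flow_eq_sum) (use F mem in \<open>auto simp: F_def crossing_def\<close>)
  also have "\<dots> = (\<Sum>h\<in>F. of_bool (h \<in> W)) - (\<Sum>h\<in>F. of_bool (h \<in> (\<lambda>h. h \<otimes> inv g) ` W))"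
    using F mem by (auto simp: sum_subtractf subset_iff cong: sum.cong)
  also have "\<dots> = int (card W) - int (card ((\<lambda>h. h \<otimes> inv g) ` W))"
    using F by (simp add: F_def Int_absorb1 Int_commute)
  also have "card ((\<lambda>h. h \<otimes> inv g) ` W) = card W"
    using assms by (intro card_image inj_onI) (metis inv_closed right_cancel subsetD)
  finally show ?thesis by simp
qed

text \<open>Only finitely many cosets \<open>x\<langle>s\<rangle>\<close> contribute to the flow, and the part \<open>W\<close> of \<open>A\<close> lying on
  them is finite, so \<open>A\<close> has the same flow as a finite set.\<close>

lemma flow_eq_0_if_limits:
  assumes A: "almost_invariant A" and s: "s \<in> carrier G"
    and lim: "\<And>x. x \<in> carrier G \<Longrightarrow> limit_along A x s False"
  shows "flow A s = 0"
proof -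
  define W where "W = (\<Union>x\<in>crossing A s. (\<lambda>k::int. x \<otimes> s [^] k) ` {k. x \<otimes> s [^] k \<in> A})"
  have fin: "finite (crossing A s)" and cr: "crossing A s \<subseteq> carrier G" and Ac: "A \<subseteq> carrier G"
    using A s by (auto simp: almost_invariant_def crossing_def)
  have W: "finite W" "W \<subseteq> A"
    using fin cr lim by (auto simp: W_def limit_along_def subset_iff)
  have mem: "h \<in> W \<longleftrightarrow> h \<in> A" "h \<otimes> s \<in> W \<longleftrightarrow> h \<otimes> s \<in> A" if "h \<in> crossing A s" for h
  proof -
    have h: "h \<in> carrier G" using that cr by blast
    have "h \<otimes> s [^] k \<in> W" if "h \<otimes> s [^] k \<in> A" for k :: int
      using that \<open>h \<in> crossing A s\<close> by (auto simp: W_def)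
    from this[of 0] this[of 1] show "h \<in> W \<longleftrightarrow> h \<in> A" "h \<otimes> s \<in> W \<longleftrightarrow> h \<otimes> s \<in> A"
      using h s W(2) by auto
  qed
  \<comment> \<open>\<open>W\<close> contains all of \<open>A\<close> on each coset that it meets,
    and h, h s share a coset; hence \<open>W\<close> can change between them only where
    \<open>A\<close> does.\<close>
  have shift: "h \<in> crossing A s" if "h \<in> crossing W s" for h
  proof (rule ccontr)
    assume n: "h \<notin> crossing A s"
    have h: "h \<in> carrier G" "(h \<in> W) \<noteq> (h \<otimes> s \<in> W)" using that by (auto simp: crossing_def)
    then have "h \<in> A" "h \<otimes> s \<in> A" using n W(2) by (auto simp: crossing_def)
    have "\<exists>x k. x \<in> crossing A s \<and> h = x \<otimes> s [^] (k::int)"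
    proof (cases "h \<in> W")
      case True
      then show ?thesis by (auto simp: W_def)
    next
      case False
      then obtain x k where x: "x \<in> crossing A s" "h \<otimes> s = x \<otimes> s [^] (k::int)"
        using h by (auto simp: W_def)
      have xc: "x \<in> carrier G" using x cr by blast
      have "h = h \<otimes> s \<otimes> inv s" using h s by (simp add: m_assoc)
      also have "\<dots> = x \<otimes> s [^] (k - 1)" using x xc s by (simp add: m_assoc int_pow_diff)
      finally show ?thesis using x by blast
    qed
    then obtain x k where x: "x \<in> crossing A s" "h = x \<otimes> s [^] (k::int)" by blast
    have xc: "x \<in> carrier G" using x cr by blast
    have "h \<otimes> s = x \<otimes> s [^] (k + 1)" using x xc s by (simp add: m_assoc int_pow_mult)
    then have "h \<in> W" "h \<otimes> s \<in> W" using x \<open>h \<in> A\<close> \<open>h \<otimes> s \<in> A\<close> by (auto simp: W_def)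
    then show False using h by blast
  qed
  have "flow A s = (\<Sum>h\<in>crossing A s. of_bool (h \<in> W) - of_bool (h \<otimes> s \<in> W))"
    unfolding flow_def using mem by (intro sum.cong) auto
  also have "\<dots> = flow W s"
    by (rule flow_eq_sum[symmetric]) (use fin cr shift in auto)
  also have "\<dots> = 0" using W Ac s by (intro flow_finite) auto
  finally show ?thesis .
qed

lemma flow_eq_0:
  assumes A: "almost_invariant A" and S: "generating_set G S"
    and lim: "\<And>x s. x \<in> carrier G \<Longrightarrow> s \<in> S \<Longrightarrow> limit_along A x s False"
    and g: "g \<in> carrier G"
  shows "flow A g = 0"
proof -
  have S': "S \<subseteq> carrier G" "generate G S = carrier G"
    using S by (auto simp: generating_set_def)
  have one: "flow A \<one> = 0" using flow_mult[OF A, of \<one> \<one>] by simp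
  have "flow A g = 0" if "g \<in> generate G S" for g
    using that
  proof induction
    case one
    then show ?case by (rule \<open>flow A \<one> = 0\<close>)
  next
    case (incl s)
    then show ?case using flow_eq_0_if_limits[OF A] S' lim by blast
  next
    case (inv s)
    then have "s \<in> carrier G" "flow A s = 0" using flow_eq_0_if_limits[OF A] S' lim by blast+
    then show ?case using flow_mult[OF A, of s "inv s"] one by simp
  next
    case (eng g g')
    then show ?case using flow_mult[OF A] S' by simp
  qed
  then show ?thesis using g S' by simp
qed

lemma flow_eq_card_diff:
  assumes "finite (crossing A g)"
  shows "flow A g = int (card {h \<in> carrier G. h \<in> A \<and> h \<otimes> g \<notin> A})
    - int (card {h \<in> carrier G. h \<notin> A \<and> h \<otimes> g \<in> A})"
    (is "_ = int (card ?X) - int (card ?Y)")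
proof -
  have un: "crossing A g = ?X \<union> ?Y" by (auto simp: crossing_def)
  have "finite ?X" "finite ?Y" "?X \<inter> ?Y = {}" using assms unfolding un by auto
  then show ?thesis unfolding flow_def un by (subst sum.union_disjoint) auto
qed

end

section \<open>Limits of almost invariant sets along cyclic cosets\<close>

text \<open>All but finitely many rows and columns are constant, and any such row meets any such column.\<close>

lemma grid_limit:
  fixes E :: "int \<Rightarrow> int \<Rightarrow> bool"
  assumes hor: "finite {(i, j). E i j \<noteq> E (i + 1) j}" and ver: "finite {(i, j). E i j \<noteq> E i (j + 1)}"
  shows "\<exists>c. finite {i. E i 0 \<noteq> c} \<and> finite {j. E 0 j \<noteq> c}"
proof -
  have const: "f k = f 0" if "\<forall>k. f k = f (k + 1)" for f :: "int \<Rightarrow> bool" and k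
  proof (induction k rule: int_induct[where k = 0])
    case (step1 i)
    then show ?case using that by blast
  next
    case (step2 i)
    have "f (i - 1) = f i" using that spec[OF that, of "i - 1"] by simp
    then show ?case using step2 by simp
  qed simp
  \<comment> \<open>\<open>I\<close> collects the i at which E i j varies with j, \<open>J\<close>
    the j at which it varies with i; as projections of finite sets both are finite.\<close>
  define I where "I = fst ` {(i, j). E i j \<noteq> E i (j + 1)}"
  define J where "J = snd ` {(i, j). E i j \<noteq> E (i + 1) j}"
  have fin: "finite I" "finite J" using hor ver by (auto simp: I_def J_def)
  have row: "E i j = E 0 j" if "j \<notin> J" for i j
  proof -
    have "\<forall>i. E i j = E (i + 1) j" using that by (force simp: J_def)
    then show ?thesis by (rule const)
  qed
  have col: "E i j = E i 0" if "i \<notin> I" for i j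
  proof -
    have "\<forall>j. E i j = E i (j + 1)" using that by (force simp: I_def)
    then show ?thesis by (rule const)
  qed
  \<comment> \<open>The constant lines through (i0, j0) meet all other constant lines, so
    \<open>E 0 j0\<close> is their common value and serves as \<open>c\<close>.\<close>
  obtain i0 j0 where ij: "i0 \<notin> I" "j0 \<notin> J"
    using fin ex_new_if_finite[OF infinite_UNIV_int] by blast
  have "E i 0 = E 0 j0" if "i \<notin> I" for i
    using col[OF that, of j0] row[OF ij(2), of i] by simp
  then have "{i. E i 0 \<noteq> E 0 j0} \<subseteq> I" by blast
  moreover have "E 0 j = E 0 j0" if "j \<notin> J" for j
    using row[OF that, of i0] col[OF ij(1), of j] col[OF ij(1), of j0] row[OF ij(2), of i0] by simp
  then have "{j. E 0 j \<noteq> E 0 j0} \<subseteq> J" by blast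
  ultimately show ?thesis using fin by (blast intro: finite_subset)
qed

context group
begin

lemma limit_along_unique:
  assumes "limit_along A x s c" "limit_along A x s d"
  shows "c = d"
proof (rule ccontr)
  assume "c \<noteq> d"
  then have "(UNIV :: int set) = {k. (x \<otimes> s [^] k \<in> A) \<noteq> c} \<union> {k. (x \<otimes> s [^] k \<in> A) \<noteq> d}"
    by auto
  then show False using assms infinite_UNIV_int unfolding limit_along_def by (metis finite_UnI)
qed

lemma limit_along_iff:
  assumes "limit_along A x s d"
  shows "limit_along A x s c \<longleftrightarrow> c = d"
proof
  show "c = d" if "limit_along A x s c" by (rule limit_along_unique[OF that assms])
  show "limit_along A x s c" if "c = d" unfolding that by (rule assms)
qed

text \<open>Pulling a crossing back along an injective parametrisation turns almost invariance into
  finiteness over integers or pairs of integers.\<close>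

lemma finite_crossing_vimage:
  assumes "almost_invariant A" "g \<in> carrier G" "inj f" "range f \<subseteq> carrier G"
  shows "finite {i. (f i \<in> A) \<noteq> (f i \<otimes> g \<in> A)}"
proof -
  have "{i. (f i \<in> A) \<noteq> (f i \<otimes> g \<in> A)} = f -` crossing A g"
    using assms(4) by (auto simp: crossing_def)
  then show ?thesis using assms by (auto simp: almost_invariant_def intro: finite_vimageI)
qed

lemma inj_int_pow:
  assumes "s \<in> carrier G" "ord s = 0"
  shows "inj (\<lambda>k::int. s [^] k)"
  using assms by (auto intro!: injI simp: int_pow_eq)

lemma inj_int_pow_translate:
  assumes "x \<in> carrier G" "s \<in> carrier G" "ord s = 0"
  shows "inj (\<lambda>k::int. x \<otimes> s [^] k)"
  using inj_int_pow[OF assms(2,3)] assms by (auto simp: inj_def)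

lemma limit_along_shift:
  assumes "x \<in> carrier G" "s \<in> carrier G" "limit_along A x s c"
  shows "limit_along A (x \<otimes> s) s c"
proof -
  have "x \<otimes> s \<otimes> s [^] k = x \<otimes> s [^] (1 + k)" for k :: int
    using assms by (simp add: m_assoc int_pow_mult)
  then have "{k::int. (x \<otimes> s \<otimes> s [^] k \<in> A) \<noteq> c} = (\<lambda>k. 1 + k) -` {k::int. (x \<otimes> s [^] k \<in> A) \<noteq> c}"
    by auto
  then show ?thesis
    using finite_vimageI[OF assms(3)[unfolded limit_along_def], of "\<lambda>k. 1 + k"]
    unfolding limit_along_def by simp
qed

text \<open>From \<open>s\<close> to its power, restrict to multiples of \<open>b\<close>.
  Conversely, the coset of \<open>s\<close> splits into finitely many progressions with step
  \<open>b\<close>; right multiplication by a fixed s^r changes membership in \<open>A\<close> only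
  finitely often, so all of them inherit the limit of the progression with r = 0.\<close>

lemma limit_along_power:
  assumes A: "almost_invariant A" and x: "x \<in> carrier G" and s: "s \<in> carrier G" "ord s = 0"
    and b: "b \<noteq> (0 :: int)"
  shows "limit_along A x (s [^] b) c \<longleftrightarrow> limit_along A x s c"
proof
  assume L: "limit_along A x s c"
  have "{k. (x \<otimes> (s [^] b) [^] k \<in> A) \<noteq> c} = (\<lambda>k. b * k) -` {k::int. (x \<otimes> s [^] k \<in> A) \<noteq> c}"
    using s by (auto simp: int_pow_pow)
  then show "limit_along A x (s [^] b) c"
    using b finite_vimageI[OF L[unfolded limit_along_def], of "\<lambda>k. b * k"]
    unfolding limit_along_def by (simp add: inj_def)
next
  assume L: "limit_along A x (s [^] b) c"
  define B where "B r = {q::int. (x \<otimes> s [^] (b * q + r) \<in> A) \<noteq> c}" for r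
  have "finite (B r)" for r
  proof -
    have "inj (\<lambda>q::int. x \<otimes> s [^] (b * q))"
      using inj_compose[OF inj_int_pow_translate[OF x s], of "\<lambda>q. b * q"] b
      by (simp add: inj_def comp_def)
    then have "finite {q::int. (x \<otimes> s [^] (b * q) \<in> A) \<noteq> (x \<otimes> s [^] (b * q) \<otimes> s [^] r \<in> A)}"
      using A x s by (intro finite_crossing_vimage) auto
    moreover have "finite {q::int. (x \<otimes> s [^] (b * q) \<in> A) \<noteq> c}"
      using L s by (simp add: limit_along_def int_pow_pow)
    moreover have "B r \<subseteq> {q::int. (x \<otimes> s [^] (b * q) \<in> A) \<noteq> c} \<union>
        {q::int. (x \<otimes> s [^] (b * q) \<in> A) \<noteq> (x \<otimes> s [^] (b * q) \<otimes> s [^] r \<in> A)}"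
      using x s by (auto simp: B_def int_pow_mult m_assoc)
    ultimately show ?thesis by (meson finite_UnI finite_subset)
  qed
  \<comment> \<open>\<open>b\<close> may be negative, and \<open>mod\<close> takes its sign; the
    symmetric interval contains the remainders in both cases.\<close>
  moreover have "{k::int. (x \<otimes> s [^] k \<in> A) \<noteq> c} \<subseteq> (\<Union>r\<in>{-\<bar>b\<bar>..\<bar>b\<bar>}. (\<lambda>q. b * q + r) ` B r)"
  proof
    fix k :: int assume k: "k \<in> {k. (x \<otimes> s [^] k \<in> A) \<noteq> c}"
    have "k mod b \<in> {-\<bar>b\<bar>..\<bar>b\<bar>}"
      using abs_mod_less[OF b, of k] by auto
    moreover have "k = b * (k div b) + k mod b" by simp
    moreover have "k div b \<in> B (k mod b)" using k by (simp add: B_def)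
    ultimately show "k \<in> (\<Union>r\<in>{-\<bar>b\<bar>..\<bar>b\<bar>}. (\<lambda>q. b * q + r) ` B r)" by blast
  qed
  ultimately show "limit_along A x s c"
    unfolding limit_along_def by (meson finite_UN finite_atLeastAtMost_int finite_imageI finite_subset)
qed

section \<open>Commuting pairs and commensurability\<close>

lemma ord_int_pow_eq_0:
  assumes "s \<in> carrier G" "ord s = 0" "n \<noteq> (0 :: int)"
  shows "ord (s [^] n) = 0"
proof -
  have "(s [^] n) [^] int (ord (s [^] n)) = \<one>"
    using assms by (simp add: int_pow_eq_id)
  then show ?thesis using assms by (simp add: int_pow_pow int_pow_eq_id)
qed

lemma commuting_int_pow:
  assumes "u \<in> carrier G" "v \<in> carrier G" "u \<otimes> v = v \<otimes> u"
  shows "u [^] (i::int) \<otimes> v [^] (j::int) = v [^] j \<otimes> u [^] i"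
proof -
  have step: "a \<otimes> b [^] (i::int) = b [^] i \<otimes> a"
    if "a \<in> carrier G" "b \<in> carrier G" "a \<otimes> b = b \<otimes> a" for a b i
  proof -
    have eq: "a \<otimes> b \<otimes> inv a = b" using that by (simp add: m_assoc)
    have nat: "a \<otimes> b [^] (m::nat) = b [^] m \<otimes> a" for m
      using that by (metis group_commutes_pow)
    show ?thesis
    proof (cases i rule: int_cases2)
      case (nonneg m)
      then show ?thesis using nat by (simp add: int_pow_int)
    next
      case (nonpos m)
      have "inv (b [^] m) \<otimes> a = inv (b [^] m) \<otimes> (a \<otimes> b [^] m) \<otimes> inv (b [^] m)"
        using that by (simp add: m_assoc)
      also have "\<dots> = inv (b [^] m) \<otimes> b [^] m \<otimes> a \<otimes> inv (b [^] m)"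
        using that unfolding nat by (simp only: m_assoc inv_closed nat_pow_closed m_closed)
      also have "\<dots> = a \<otimes> inv (b [^] m)"
        using that by simp
      finally have "inv (b [^] m) \<otimes> a = a \<otimes> inv (b [^] m)" .
      then show ?thesis using nonpos that by (simp add: int_pow_neg_int)
    qed
  qed
  have "u \<otimes> v [^] j = v [^] j \<otimes> u" using step assms by simp
  then show ?thesis using step[of "v [^] j" u i] assms by simp
qed

text \<open>If no non-zero powers coincide, (i, j) \<mapsto> x u^i v^j embeds the integer grid, and
  \<open>grid_limit\<close> applies to the trace of \<open>A\<close> on it.\<close>

lemma commuting_limit_or_commensurable:
  assumes A: "almost_invariant A" and x: "x \<in> carrier G"
    and u: "u \<in> carrier G" "ord u = 0" and v: "v \<in> carrier G" "ord v = 0"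
    and comm: "u \<otimes> v = v \<otimes> u"
  shows "(\<exists>c. limit_along A x u c \<and> limit_along A x v c) \<or>
    (\<exists>(a::int) (b::int). a \<noteq> 0 \<and> b \<noteq> 0 \<and> u [^] a = v [^] b)"
proof (rule disjCI)
  assume "\<not> (\<exists>(a::int) (b::int). a \<noteq> 0 \<and> b \<noteq> 0 \<and> u [^] a = v [^] b)"
  then have indep: "u [^] a \<noteq> v [^] b" if "a \<noteq> 0" "b \<noteq> 0" for a b :: int
    using that by blast
  define f where "f = (\<lambda>(i::int, j::int). x \<otimes> u [^] i \<otimes> v [^] j)"
  have f: "range f \<subseteq> carrier G" using x u v by (auto simp: f_def)
  have "inj f"
  proof (rule injI, clarify)
    fix i j i' j' :: int assume "f (i, j) = f (i', j')"
    then have "u [^] i \<otimes> v [^] j = u [^] i' \<otimes> v [^] j'"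
      using x u v by (simp add: f_def m_assoc)
    then have "inv (u [^] i') \<otimes> (u [^] i \<otimes> v [^] j) \<otimes> inv (v [^] j) =
      inv (u [^] i') \<otimes> (u [^] i' \<otimes> v [^] j') \<otimes> inv (v [^] j)" by simp
    then have "inv (u [^] i') \<otimes> u [^] i = v [^] j' \<otimes> inv (v [^] j)"
      using u v by (simp add: m_assoc) (simp add: m_assoc[symmetric])
    moreover have "u [^] (i - i') = inv (u [^] i') \<otimes> u [^] i"
      using u int_pow_mult[of u "- i'" i] by (simp add: int_pow_neg)
    moreover have "v [^] (j' - j) = v [^] j' \<otimes> inv (v [^] j)"
      using v by (simp add: int_pow_diff)
    ultimately have eq: "u [^] (i - i') = v [^] (j' - j)" by simp
    have triv: "k = 0" if "w \<in> carrier G" "ord w = 0" "w [^] k = \<one>" for w and k :: int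
      using that by (simp add: int_pow_eq_id)
    \<comment> \<open>If one difference vanishes, the infinite order of the other element makes the
      second vanish too.\<close>
    have "i - i' = 0 \<or> j' - j = 0" using indep[of "i - i'" "j' - j"] eq by argo
    then show "i = i' \<and> j = j'"
    proof
      assume "i - i' = 0"
      then show ?thesis using triv[OF v, of "j' - j"] eq by simp
    next
      assume "j' - j = 0"
      then show ?thesis using triv[OF u, of "i - i'"] eq by simp
    qed
  qed
  define E where "E i j = (f (i, j) \<in> A)" for i j
  have "finite {p. (f p \<in> A) \<noteq> (f p \<otimes> u \<in> A)}" "finite {p. (f p \<in> A) \<noteq> (f p \<otimes> v \<in> A)}"
    by (rule finite_crossing_vimage[OF A u(1) \<open>inj f\<close> f],
        rule finite_crossing_vimage[OF A v(1) \<open>inj f\<close> f])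
  \<comment> \<open>Commutation lets \<open>u\<close> pass the power of \<open>v\<close>, so right
    multiplication by \<open>u\<close> is a step in the grid.\<close>
  moreover have "f p \<otimes> u = f (fst p + 1, snd p)" for p
    using x u v commuting_int_pow[OF u(1) v(1) comm, of 1 "snd p"]
    by (simp add: f_def m_assoc int_pow_mult case_prod_unfold)
  moreover have "f p \<otimes> v = f (fst p, snd p + 1)" for p
    using x u v by (simp add: f_def m_assoc int_pow_mult case_prod_unfold)
  ultimately have "finite {(i, j). E i j \<noteq> E (i + 1) j}" "finite {(i, j). E i j \<noteq> E i (j + 1)}"
    by (simp_all add: E_def case_prod_unfold)
  from grid_limit[OF this] obtain c where "finite {i. E i 0 \<noteq> c}" "finite {j. E 0 j \<noteq> c}"
    by blast
  then show "\<exists>c. limit_along A x u c \<and> limit_along A x v c"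
    unfolding limit_along_def E_def f_def using x u v by auto
qed

lemma comm_subgroup_generatedD:
  assumes "comm_group (subgroup_generated G {u, v})" "u \<in> carrier G" "v \<in> carrier G"
  shows "u \<otimes> v = v \<otimes> u"
proof -
  interpret K: comm_group "subgroup_generated G {u, v}" by fact
  have "u \<in> carrier (subgroup_generated G {u, v})" "v \<in> carrier (subgroup_generated G {u, v})"
    using assms by (simp_all add: carrier_subgroup_generated generate.incl)
  then show ?thesis using K.m_comm by simp
qed

text \<open>If u^a = v^b, the b-th power of every element of the abelian group is a power of
  \<open>u\<close>. Any two elements then satisfy a relation that two free generators
  violate.\<close>

lemma rank_2_not_commensurable:
  assumes K: "comm_group (subgroup_generated G {u, v})" and uv: "u \<in> carrier G" "v \<in> carrier G"
    and rank: "has_rank (subgroup_generated G {u, v}) 2"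
    and ab: "a \<noteq> 0" "b \<noteq> 0"
  shows "u [^] (a::int) \<noteq> v [^] (b::int)"
proof
  assume eq: "u [^] a = v [^] b"
  define K where "K = subgroup_generated G {u, v}"
  interpret K: comm_group K using K by (simp add: K_def)
  have pow: "w [^]\<^bsub>K\<^esub> i = w [^] i" if "w \<in> carrier K" for w and i :: int
    using that unfolding K_def by (rule int_pow_subgroup_generated)
  have gens: "u \<in> carrier K" "v \<in> carrier K"
    using uv by (simp_all add: K_def carrier_subgroup_generated generate.incl)
  have cyc: "\<exists>p::int. w [^]\<^bsub>K\<^esub> b = u [^]\<^bsub>K\<^esub> p" if "w \<in> carrier K" for w
  proof -
    have "w \<in> generate G {u, v}" using that uv by (simp add: K_def carrier_subgroup_generated)
    \<comment> \<open>Membership in \<open>K\<close> is carried through the induction because the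
      power laws of \<open>K\<close> require it.\<close>
    then have "w \<in> carrier K \<and> (\<exists>p::int. w [^]\<^bsub>K\<^esub> b = u [^]\<^bsub>K\<^esub> p)"
    proof induction
      case one
      have "\<one>\<^bsub>K\<^esub> [^]\<^bsub>K\<^esub> b = u [^]\<^bsub>K\<^esub> (0::int)" by simp
      moreover have "\<one>\<^bsub>K\<^esub> = \<one>" by (simp add: K_def)
      ultimately show ?case using K.one_closed by metis
    next
      case (incl w)
      have "u [^]\<^bsub>K\<^esub> b = u [^]\<^bsub>K\<^esub> b" "v [^]\<^bsub>K\<^esub> b = u [^]\<^bsub>K\<^esub> a"
        using gens eq by (simp_all add: pow)
      then show ?case using incl gens by blast
    next
      case (inv w)
      have "inv w = inv\<^bsub>K\<^esub> w" using inv gens by (auto simp: K_def)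
      moreover have "w \<in> carrier K" using inv gens by auto
      moreover have "(inv\<^bsub>K\<^esub> w) [^]\<^bsub>K\<^esub> b = w [^]\<^bsub>K\<^esub> (- b)" using \<open>w \<in> carrier K\<close>
        by (simp add: K.int_pow_inv K.int_pow_neg)
      moreover have "u [^]\<^bsub>K\<^esub> (- b) = u [^]\<^bsub>K\<^esub> (- b)" "v [^]\<^bsub>K\<^esub> (- b) = u [^]\<^bsub>K\<^esub> (- a)"
        using gens eq by (simp_all add: pow int_pow_neg uv)
      ultimately show ?case using inv by (metis K.inv_closed empty_iff insert_iff)
    next
      case (eng w w')
      then obtain p q :: int where "w [^]\<^bsub>K\<^esub> b = u [^]\<^bsub>K\<^esub> p" "w' [^]\<^bsub>K\<^esub> b = u [^]\<^bsub>K\<^esub> q"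
        by blast
      then have "(w \<otimes>\<^bsub>K\<^esub> w') [^]\<^bsub>K\<^esub> b = u [^]\<^bsub>K\<^esub> (p + q)"
        using eng gens by (simp add: K.int_pow_distrib K.int_pow_mult)
      moreover have "w \<otimes> w' = w \<otimes>\<^bsub>K\<^esub> w'" by (simp add: K_def)
      ultimately show ?case using eng by auto
    qed
    then show ?thesis by blast
  qed
  obtain H \<phi> where H: "subgroup H K" and \<phi>: "\<phi> \<in> iso (K\<lparr>carrier := H\<rparr>) (free_Abelian_group {..<2::nat})"
    using rank unfolding has_rank_def finite_index_subgroup_def is_iso_def K_def by blast
  have grp: "group (K\<lparr>carrier := H\<rparr>)" using H by (rule K.subgroup_imp_group)
  have bij: "bij_betw \<phi> H (carrier (free_Abelian_group {..<2::nat}))"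
    and hom: "\<phi> \<in> hom (K\<lparr>carrier := H\<rparr>) (free_Abelian_group {..<2::nat})"
    using \<phi> by (auto simp: iso_def)
  have \<phi>_pow: "\<phi> (w [^]\<^bsub>K\<^esub> i) = frag_cmul i (\<phi> w)" if "w \<in> H" for w and i :: int
  proof -
    have "Poly_Mapping.keys (\<phi> w) \<subseteq> {..<2}"
      using bij_betwE[OF bij] that by simp
    then show ?thesis
      using hom_int_pow[OF hom _ grp group_free_Abelian_group, of w i] that
      unfolding K.int_pow_consistent[OF H that] by simp
  qed
  have surj: "frag_of m \<in> \<phi> ` H" if "m < 2" for m
    using bij_betw_imp_surj_on[OF bij] that by simp
  obtain e0 where e0: "e0 \<in> H" "\<phi> e0 = frag_of 0"
    using surj[of 0] by (force simp del: frag_of_eq)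
  obtain e1 where e1: "e1 \<in> H" "\<phi> e1 = frag_of 1"
    using surj[of 1] by (force simp del: frag_of_eq)
  have ec: "e0 \<in> carrier K" "e1 \<in> carrier K"
    using e0(1) e1(1) subgroup.mem_carrier[OF H] by blast+
  obtain p0 p1 :: int where p: "e0 [^]\<^bsub>K\<^esub> b = u [^]\<^bsub>K\<^esub> p0" "e1 [^]\<^bsub>K\<^esub> b = u [^]\<^bsub>K\<^esub> p1"
    using cyc ec by blast
  \<comment> \<open>Raising each b-th power to the exponent of the other produces the same power of
    \<open>u\<close>.\<close>
  have "e0 [^]\<^bsub>K\<^esub> (b * p1) = u [^]\<^bsub>K\<^esub> (p0 * p1)" "e1 [^]\<^bsub>K\<^esub> (b * p0) = u [^]\<^bsub>K\<^esub> (p1 * p0)"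
    using p K.int_pow_pow[OF ec(1), of b p1] K.int_pow_pow[OF ec(2), of b p0]
      K.int_pow_pow[OF gens(1)] by simp_all
  then have "frag_cmul (b * p1) (frag_of (0::nat)) = frag_cmul (b * p0) (frag_of 1)"
    using \<phi>_pow[OF e0(1), of "b * p1"] \<phi>_pow[OF e1(1), of "b * p0"] e0(2) e1(2)
    by (simp add: mult.commute)
  \<comment> \<open>The coefficient at generator 1 is 0 on the left and b p0 on the right. So p0 =
    0, and b times generator 0 would vanish.\<close>
  then have "Poly_Mapping.lookup (frag_cmul (b * p1) (frag_of (0::nat))) 1 =
      Poly_Mapping.lookup (frag_cmul (b * p0) (frag_of 1)) 1"
    by simp
  then have "p0 = 0" using ab by (simp add: lookup_single del: single_one)
  then have "e0 [^]\<^bsub>K\<^esub> b = e0 [^]\<^bsub>K\<^esub> (0::int)" using p(1) by simp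
  then have "frag_cmul b (frag_of (0::nat)) = frag_cmul 0 (frag_of 0)"
    using \<phi>_pow[OF e0(1)] e0(2) by metis
  then show False using ab by simp
qed

end

section \<open>Spreading limits over the generators and the base points\<close>

context group
begin

text \<open>Non-zero powers of \<open>r\<close> and \<open>r'\<close> commute: either they have a
  common limit, or they have a common non-zero power. In both cases \<open>limit_along_power\<close>
  returns to \<open>r\<close> and \<open>r'\<close>.\<close>

lemma adjacent_limit_along_iff:
  assumes A: "almost_invariant A" and x: "x \<in> carrier G" and S: "S \<subseteq> carrier G" "\<forall>r\<in>S. ord r = 0"
    and adj: "(r, r') \<in> parcs (commutativity_graph G S)"
  shows "limit_along A x r c \<longleftrightarrow> limit_along A x r' c"
proof -
  obtain m m' :: int where m: "m \<noteq> 0" "m' \<noteq> 0"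
    and K: "comm_group (subgroup_generated G {r [^] m, r' [^] m'})"
    and "r \<in> S" "r' \<in> S"
    using adj by (auto simp: commutativity_graph_def)
  then have r: "r \<in> carrier G" "ord r = 0" and r': "r' \<in> carrier G" "ord r' = 0"
    using S by auto
  have u: "r [^] m \<in> carrier G" "ord (r [^] m) = 0" and v: "r' [^] m' \<in> carrier G" "ord (r' [^] m') = 0"
    using r r' m by (simp_all add: ord_int_pow_eq_0)
  have "r [^] m \<otimes> r' [^] m' = r' [^] m' \<otimes> r [^] m"
    using comm_subgroup_generatedD[OF K] u v by simp
  from commuting_limit_or_commensurable[OF A x u v this]
  show ?thesis
  proof (elim disjE exE conjE)
    fix d assume "limit_along A x (r [^] m) d" "limit_along A x (r' [^] m') d"
    then have "limit_along A x r d" "limit_along A x r' d"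
      using limit_along_power[OF A x r m(1)] limit_along_power[OF A x r' m(2)] by simp_all
    from this[THEN limit_along_iff] show ?thesis by simp
  next
    fix a b :: int assume ab: "a \<noteq> 0" "b \<noteq> 0" "(r [^] m) [^] a = (r' [^] m') [^] b"
    then show ?thesis
      using limit_along_power[OF A x r m(1)] limit_along_power[OF A x r' m(2)]
        limit_along_power[OF A x u ab(1)] limit_along_power[OF A x v ab(2)] by simp
  qed
qed

text \<open>Rank 2 rules out commensurability and so yields a limit along \<open>s\<close>;
  adjacency only transports limits, and connectedness carries this one to all of
  \<open>S\<close>.\<close>

lemma limit_along_generating_set:
  assumes A: "almost_invariant A" and x: "x \<in> carrier G" and S: "S \<subseteq> carrier G" "\<forall>r\<in>S. ord r = 0"
    and conn: "Digraph_Component.connected (with_proj (commutativity_graph G S))"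
    and s: "s \<in> S" "s' \<in> S" and n: "n \<noteq> (0::int)" "n' \<noteq> (0::int)"
    and K: "comm_group (subgroup_generated G {s [^] n, s' [^] n'})"
    and rank: "has_rank (subgroup_generated G {s [^] n, s' [^] n'}) 2"
  shows "\<exists>c. \<forall>r\<in>S. limit_along A x r c"
proof -
  have sc: "s \<in> carrier G" "ord s = 0" and s'c: "s' \<in> carrier G" "ord s' = 0"
    using s S by auto
  have u: "s [^] n \<in> carrier G" "ord (s [^] n) = 0" and v: "s' [^] n' \<in> carrier G" "ord (s' [^] n') = 0"
    using sc s'c n by (simp_all add: ord_int_pow_eq_0)
  have "s [^] n \<otimes> s' [^] n' = s' [^] n' \<otimes> s [^] n"
    using comm_subgroup_generatedD[OF K] u v by simp
  from commuting_limit_or_commensurable[OF A x u v this]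
  obtain c where "limit_along A x (s [^] n) c"
    using rank_2_not_commensurable[OF K u(1) v(1) rank] by blast
  then have c: "limit_along A x s c" using limit_along_power[OF A x sc n(1)] by simp
  have "limit_along A x r c" if "r \<in> S" for r
  proof -
    \<comment> \<open>Connectedness of a digraph refers to its symmetric closure, so a path may use
      an arc in either direction; the adjacency lemma is an equivalence and covers both.\<close>
    let ?H = "mk_symmetric (with_proj (commutativity_graph G S))"
    have "s \<rightarrow>\<^sup>*\<^bsub>with_proj ?H\<^esub> r"
      using conn that s
      by (auto simp: connected_def strongly_connected_def mk_symmetric_def commutativity_graph_def)
    then have "(s, r) \<in> rtrancl_on S (parcs ?H)"
      by (simp add: reachable_def mk_symmetric_def commutativity_graph_def)
    then show ?thesis
    proof (induction rule: rtrancl_on_induct)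
      case base
      show ?case by (rule c)
    next
      case (step y z)
      then have "(y, z) \<in> parcs (commutativity_graph G S) \<or> (z, y) \<in> parcs (commutativity_graph G S)"
        by (auto simp: mk_symmetric_def)
      then show ?case using adjacent_limit_along_iff[OF A x S] step.IH by blast
    qed
  qed
  then show ?thesis by blast
qed

text \<open>For \<open>t\<close> in \<open>S\<close>, \<open>x\<close> and x t lie on the same coset
  of \<open>t\<close>, which forces their values to agree; \<open>S\<close> generates, so every base
  point is reached from \<one>.\<close>

lemma limit_along_independent_of_base:
  assumes S: "generating_set G S"
    and ex: "\<And>x. x \<in> carrier G \<Longrightarrow> \<exists>c. \<forall>r\<in>S. limit_along A x r c"
  shows "\<exists>c. \<forall>x\<in>carrier G. \<forall>r\<in>S. limit_along A x r c"
proof -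
  have S': "S \<subseteq> carrier G" "generate G S = carrier G"
    using S by (auto simp: generating_set_def)
  define Lim where "Lim x c \<longleftrightarrow> (\<forall>r\<in>S. limit_along A x r c)" for x c
  have step: "Lim x c \<longleftrightarrow> Lim (x \<otimes> t) c" if x: "x \<in> carrier G" and t: "t \<in> S" for x t c
  proof -
    have tc: "t \<in> carrier G" using t S' by blast
    obtain d where d: "Lim x d" using ex[OF x] by (auto simp: Lim_def)
    obtain e where e: "Lim (x \<otimes> t) e" using ex[of "x \<otimes> t"] x tc by (auto simp: Lim_def)
    have "limit_along A (x \<otimes> t) t d"
      using d t limit_along_shift[OF x tc] by (simp add: Lim_def)
    then have "e = d" using e t limit_along_iff by (auto simp: Lim_def)
    moreover have "Lim y c \<longleftrightarrow> c = a" if "Lim y a" for y a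
    proof
      show "c = a" if "Lim y c"
        using that \<open>Lim y a\<close> t limit_along_unique[of A y t c a] by (simp add: Lim_def)
    qed (use that in simp)
    ultimately show ?thesis using d e by simp
  qed
  have "Lim (x \<otimes> g) c" if "g \<in> generate G S" "x \<in> carrier G" "Lim x c" for x g c
    using that
  proof (induction arbitrary: x)
    case one
    then show ?case by simp
  next
    case (incl t)
    then show ?case using step by blast
  next
    case (inv t)
    then have "t \<in> carrier G" using S' by blast
    then have "x \<otimes> inv t \<otimes> t = x" using inv by (simp add: m_assoc)
    then show ?case using step[of "x \<otimes> inv t" t c] inv \<open>t \<in> carrier G\<close> by simp
  next
    case (eng g g')
    then have "g \<in> carrier G" "g' \<in> carrier G" using S' by auto
    then show ?case using eng.IH(2)[OF _ eng.IH(1)[OF eng.prems]] eng.prems by (simp add: m_assoc)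
  qed
  moreover obtain c where "Lim \<one> c" using ex[of \<one>] by (auto simp: Lim_def)
  ultimately have "Lim x c" if "x \<in> carrier G" for x
    using that S' by (metis l_one one_closed)
  then show ?thesis unfolding Lim_def by blast
qed

end

section \<open>Sides of a finite connected set in the Cayley graph\<close>

locale cayley = group +
  fixes T
  assumes finite_T: "finite T" and generating_T: "generating_set G T"
begin

abbreviation edges :: "('a \<times> 'a) set" where
  "edges \<equiv> parcs (cayley_graph G T)"

lemma T_carrier: "T \<subseteq> carrier G"
  using generating_T by (simp add: generating_set_def)

lemma edges_carrier: "(u, v) \<in> edges \<Longrightarrow> u \<in> carrier G \<and> v \<in> carrier G"
  by (simp add: cayley_graph_def)

lemma edges_sym: "(u, v) \<in> edges \<Longrightarrow> (v, u) \<in> edges"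
  by (auto simp: cayley_graph_def)

lemma edges_mult: "g \<in> carrier G \<Longrightarrow> t \<in> T \<Longrightarrow> (g, g \<otimes> t) \<in> edges"
  using T_carrier by (auto simp: cayley_graph_def)

text \<open>Edges come from right multiplication, so left multiplication preserves them.\<close>

lemma edges_translate:
  assumes "x \<in> carrier G" "(u, v) \<in> edges"
  shows "(x \<otimes> u, x \<otimes> v) \<in> edges"
proof -
  obtain t where t: "t \<in> T" "v = u \<otimes> t \<or> u = v \<otimes> t" and uv: "u \<in> carrier G" "v \<in> carrier G"
    using assms(2) by (auto simp: cayley_graph_def)
  have "t \<in> carrier G" using t(1) T_carrier by blast
  then have "x \<otimes> v = x \<otimes> u \<otimes> t \<or> x \<otimes> u = x \<otimes> v \<otimes> t"
    using t(2) uv assms(1) by (auto simp: m_assoc)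
  then show ?thesis using t(1) uv assms(1) by (auto simp: cayley_graph_def)
qed

lemma edges_connected:
  assumes "y \<in> carrier G"
  shows "(\<one>, y) \<in> edges\<^sup>*"
proof -
  have "(g, g \<otimes> w) \<in> edges\<^sup>*" if "w \<in> generate G T" "g \<in> carrier G" for g w
    using that
  proof (induction arbitrary: g)
    case one
    then show ?case by simp
  next
    case (incl t)
    then show ?case using edges_mult by blast
  next
    case (inv t)
    then have "t \<in> carrier G" using T_carrier by blast
    then have "g \<otimes> inv t \<otimes> t = g" "g \<otimes> inv t \<in> carrier G" using inv by (simp_all add: m_assoc)
    then show ?case using edges_sym[OF edges_mult[of "g \<otimes> inv t" t]] inv by auto
  next
    case (eng w w')
    then have "w \<in> carrier G" "w' \<in> carrier G"
      using generating_T by (auto simp: generating_set_def)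
    then show ?case
      using eng.IH(1)[OF eng.prems] eng.IH(2)[of "g \<otimes> w"] eng.prems by (simp add: m_assoc)
  qed
  from this[of y \<one>] show ?thesis
    using assms generating_T by (simp add: generating_set_def)
qed

lemma edges_connected':
  assumes "y \<in> carrier G"
  shows "(y, \<one>) \<in> edges\<^sup>*"
  using edges_connected[OF assms] edges_sym by (meson symD symI sym_rtrancl)

lemma finite_neighbours:
  assumes "finite F"
  shows "finite (edges `` F)"
proof -
  have "edges `` F \<subseteq> (\<lambda>(u, t). u \<otimes> t) ` (F \<times> T) \<union> (\<lambda>(u, t). u \<otimes> inv t) ` (F \<times> T)"
  proof
    fix v assume "v \<in> edges `` F"
    then obtain u t where ut: "u \<in> F" "t \<in> T" "u \<in> carrier G" "v \<in> carrier G" "v = u \<otimes> t \<or> u = v \<otimes> t"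
      by (auto simp: cayley_graph_def)
    then have "v = u \<otimes> t \<or> v = u \<otimes> inv t"
      using T_carrier by (auto simp: m_assoc)
    then show "v \<in> (\<lambda>(u, t). u \<otimes> t) ` (F \<times> T) \<union> (\<lambda>(u, t). u \<otimes> inv t) ` (F \<times> T)"
      using ut by auto
  qed
  then show ?thesis using assms finite_T by (meson finite_SigmaI finite_UnI finite_imageI finite_subset)
qed

end

text \<open>\<open>A\<close> is a union of connected components of the complement of a finite connected set \<open>K\<close>.\<close>

locale cayley_side = cayley +
  fixes K A
  assumes finite_K: "finite K" and K_carrier: "K \<subseteq> carrier G" and one_K: "\<one> \<in> K"
    and K_connected: "\<And>y. y \<in> K \<Longrightarrow> (\<one>, y) \<in> (edges \<inter> K \<times> K)\<^sup>*"
    and A_subset: "A \<subseteq> carrier G - K"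
    and A_closed: "\<And>u v. u \<in> A \<Longrightarrow> (u, v) \<in> edges \<Longrightarrow> v \<notin> K \<Longrightarrow> v \<in> A"
begin

lemma A_edge: "(u, v) \<in> edges \<Longrightarrow> u \<notin> K \<Longrightarrow> v \<notin> K \<Longrightarrow> u \<in> A \<longleftrightarrow> v \<in> A"
  using A_closed edges_sym by blast

text \<open>An edge from h to h t that leaves or enters \<open>A\<close> has an end in the finite
  set \<open>K\<close>.\<close>

lemma almost_invariant: "almost_invariant A"
proof (rule almost_invariantI[OF _ generating_T])
  fix t assume t: "t \<in> T"
  then have tc: "t \<in> carrier G" using T_carrier by blast
  have "crossing A t \<subseteq> K \<union> (\<lambda>k. k \<otimes> inv t) ` K"
  proof
    fix h assume h: "h \<in> crossing A t"
    then have hc: "h \<in> carrier G" by (simp add: crossing_def)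
    then have "h \<in> K \<or> h \<otimes> t \<in> K"
      using A_edge[OF edges_mult[OF hc t]] h by (auto simp: crossing_def)
    moreover have "h = h \<otimes> t \<otimes> inv t" using hc tc by (simp add: m_assoc)
    ultimately show "h \<in> K \<union> (\<lambda>k. k \<otimes> inv t) ` K" by blast
  qed
  then show "finite (crossing A t)" using finite_K by (meson finite_UnI finite_imageI finite_subset)
qed (use A_subset in blast)

text \<open>This is the finite set K K^-1; outside it the translate g K is disjoint from
  \<open>K\<close>.\<close>

definition overlaps :: "'a set" where
  "overlaps = {g \<in> carrier G. \<exists>k\<in>K. g \<otimes> k \<in> K}"

lemma finite_overlaps: "finite overlaps"
proof -
  have "overlaps \<subseteq> (\<lambda>(a, b). a \<otimes> inv b) ` (K \<times> K)"
  proof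
    fix g assume "g \<in> overlaps"
    then obtain k where k: "g \<in> carrier G" "k \<in> K" "g \<otimes> k \<in> K" by (auto simp: overlaps_def)
    then have "g = g \<otimes> k \<otimes> inv k" using K_carrier by (auto simp: m_assoc)
    then show "g \<in> (\<lambda>(a, b). a \<otimes> inv b) ` (K \<times> K)" using k by force
  qed
  then show ?thesis using finite_K by (meson finite_SigmaI finite_imageI finite_subset)
qed

text \<open>The translate g K is connected, avoids \<open>K\<close> and contains g itself, which
  lies in \<open>A\<close>.\<close>

lemma translate_K_subset:
  assumes g: "g \<in> A" "g \<notin> overlaps" and y: "y \<in> K"
  shows "g \<otimes> y \<in> A"
  using K_connected[OF y]
proof induction
  case base
  then show ?case using g A_subset by auto
next
  case (step y z)
  have gc: "g \<in> carrier G" using g A_subset by blast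
  then have "g \<otimes> z \<notin> K" using g step by (auto simp: overlaps_def)
  then show ?case using A_closed[OF step.IH edges_translate[OF gc]] step by blast
qed

text \<open>The translate \<open>g K\<close> lies inside \<open>A\<close>, so the complement of \<open>A\<close>, in which every point is joined
  to \<open>\<one>\<close>, lies on one side of \<open>g K\<close>.\<close>

lemma complement_on_one_side:
  assumes g: "g \<in> A" "g \<notin> overlaps" and y: "y \<in> carrier G" "y \<notin> A"
  shows "inv g \<otimes> y \<in> A \<longleftrightarrow> inv g \<in> A"
proof -
  have gc: "g \<in> carrier G" using g A_subset by blast
  \<comment> \<open>An edge outside \<open>A\<close> also avoids g K; translated by
    \<open>inv g\<close> it avoids \<open>K\<close>, so its ends lie on one side.\<close>
  have edge: "inv g \<otimes> u \<in> A \<longleftrightarrow> inv g \<otimes> v \<in> A" if uv: "(u, v) \<in> edges" "u \<notin> A" "v \<notin> A" for u v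
  proof -
    have "w = g \<otimes> (inv g \<otimes> w)" if "w \<in> carrier G" for w
      using that gc by (simp add: m_assoc[symmetric])
    then have "inv g \<otimes> u \<notin> K" "inv g \<otimes> v \<notin> K"
      using translate_K_subset[OF g] uv edges_carrier[OF uv(1)] by metis+
    then show ?thesis using A_edge[OF edges_translate[OF _ uv(1), of "inv g"]] gc by simp
  qed
  have K: "inv g \<otimes> y \<in> A \<longleftrightarrow> inv g \<in> A" if "y \<in> K" for y
    using K_connected[OF that]
  proof induction
    case base
    then show ?case using gc by simp
  next
    case (step y z)
    then show ?case using edge[of y z] A_subset by blast
  qed
  \<comment> \<open>A path from \<open>y\<close> to \<one> stays outside \<open>A\<close> until it
    meets \<open>K\<close>, where the previous fact takes over.\<close>
  show ?thesis
    using edges_connected'[OF y(1)] y(2)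
  proof (induction rule: converse_rtrancl_induct)
    case base
    then show ?case using gc by simp
  next
    case (step y z)
    show ?case
    proof (cases "y \<in> K")
      case True
      then show ?thesis by (rule K)
    next
      case False
      then have "z \<notin> A" using A_closed[OF _ edges_sym[OF step.hyps(1)]] step.prems by blast
      then show ?thesis using edge[OF step.hyps(1)] step by blast
    qed
  qed
qed

text \<open>Failure would put \<open>inv g\<close> times the whole complement of \<open>A\<close>
  into \<open>A\<close>. But for all but finitely many k, neither s^k nor g^-1 s^k lies in
  \<open>A\<close>.\<close>

lemma translate_subset:
  assumes s: "s \<in> carrier G" and lim: "\<And>x. x \<in> carrier G \<Longrightarrow> limit_along A x s False"
    and g: "g \<in> A" "g \<notin> overlaps" and a: "a \<in> A"
  shows "g \<otimes> a \<in> A"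
proof (rule ccontr)
  assume n: "g \<otimes> a \<notin> A"
  have gc: "g \<in> carrier G" and ac: "a \<in> carrier G" using g a A_subset by auto
  have "inv g \<otimes> (g \<otimes> a) = a" using gc ac by (simp add: m_assoc[symmetric])
  then have "inv g \<in> A" using complement_on_one_side[OF g, of "g \<otimes> a"] n gc ac a by simp
  then have inside: "inv g \<otimes> y \<in> A" if "y \<in> carrier G" "y \<notin> A" for y
    using complement_on_one_side[OF g that] by simp
  have "finite {k::int. \<one> \<otimes> s [^] k \<in> A}" "finite {k::int. inv g \<otimes> s [^] k \<in> A}"
    using lim[of \<one>] lim[of "inv g"] gc by (simp_all add: limit_along_def)
  then have "finite ({k::int. \<one> \<otimes> s [^] k \<in> A} \<union> {k::int. inv g \<otimes> s [^] k \<in> A})" by simp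
  then obtain k :: int where "\<one> \<otimes> s [^] k \<notin> A" "inv g \<otimes> s [^] k \<notin> A"
    using ex_new_if_finite[OF infinite_UNIV_int] by (metis (mono_tags, lifting) UnCI mem_Collect_eq)
  then show False using inside[of "s [^] k"] s by simp
qed

text \<open>At most \<open>card overlaps\<close> elements leave \<open>A\<close> under right multiplication by \<open>g\<^sup>N\<close>, whereas all
  \<open>g\<^sup>-\<^sup>j\<close> with \<open>0 \<le> j < N\<close> enter it; for large \<open>N\<close> this contradicts the vanishing of the flow.\<close>

lemma finite_A:
  assumes S: "generating_set G S" "S \<noteq> {}"
    and lim: "\<And>x s. x \<in> carrier G \<Longrightarrow> s \<in> S \<Longrightarrow> limit_along A x s False"
  shows "finite A"
proof (rule ccontr)
  assume "infinite A"
  obtain s where s: "s \<in> S" "s \<in> carrier G" using S by (auto simp: generating_set_def)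
  have absorb: "g \<otimes> a \<in> A" if "g \<in> A" "g \<notin> overlaps" "a \<in> A" for g a
    using translate_subset[OF s(2) _ that] lim s(1) by blast
  obtain g where g: "g \<in> A" "g \<notin> overlaps"
    using \<open>infinite A\<close> finite_overlaps by (meson finite_subset subsetI)
  have gc: "g \<in> carrier G" using g A_subset by blast
  have one: "\<one> \<notin> A" using one_K A_subset by blast
  have shift: "g [^] n \<otimes> a \<in> A" if "a \<in> A" for a and n :: nat
  proof (induction n)
    case 0
    then show ?case using that A_subset by auto
  next
    case (Suc n)
    have "a \<in> carrier G" using that A_subset by blast
    then have "g [^] Suc n \<otimes> a = g \<otimes> (g [^] n \<otimes> a)"
      using gc by (subst nat_pow_Suc2) (simp_all add: m_assoc)
    then show ?case using absorb[OF g Suc] by simp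
  qed
  have pow: "g [^] n \<in> A" if "n > 0" for n :: nat
    using shift[OF g(1), of "n - 1"] that by (metis Suc_pred' nat_pow_Suc)
  \<comment> \<open>With this \<open>N\<close>, \<open>X\<close> has fewer than \<open>N\<close>
    elements and \<open>Y\<close> at least \<open>N\<close>, while zero flow makes them equal in
    size.\<close>
  define N where "N = Suc (card overlaps)"
  define X where "X = {h \<in> carrier G. h \<in> A \<and> h \<otimes> g [^] N \<notin> A}"
  define Y where "Y = {h \<in> carrier G. h \<notin> A \<and> h \<otimes> g [^] N \<in> A}"
  have fin: "finite (crossing A (g [^] N))"
    using almost_invariant gc by (simp add: almost_invariant_def)
  have "flow A (g [^] N) = 0" by (rule flow_eq_0[OF almost_invariant S(1) lim]) (use gc in auto)
  then have "card X = card Y" using flow_eq_card_diff[OF fin] by (simp add: X_def Y_def)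
  \<comment> \<open>An h in \<open>A\<close> outside \<open>overlaps\<close> maps \<open>A\<close>
    into itself, and g^N lies in \<open>A\<close>, so h g^N cannot leave.\<close>
  moreover have "X \<subseteq> overlaps"
    using absorb pow[of N] by (auto simp: X_def N_def)
  then have "card X < N" using finite_overlaps by (simp add: N_def card_mono le_imp_less_Suc)
  moreover have "(\<lambda>j. inv (g [^] j)) ` {..<N} \<subseteq> Y"
  proof clarify
    fix j assume "j < N"
    then have "g [^] N = g [^] j \<otimes> g [^] (N - j)" using gc by (simp add: nat_pow_mult)
    then have "inv (g [^] j) \<otimes> g [^] N = g [^] (N - j)"
      using gc by (simp add: m_assoc[symmetric])
    \<comment> \<open>Otherwise multiplication by g^j would put \<one> into
      \<open>A\<close>.\<close>
    moreover have "inv (g [^] j) \<notin> A" using shift[of "inv (g [^] j)" j] one gc by auto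
    ultimately show "inv (g [^] j) \<in> Y" using pow[of "N - j"] \<open>j < N\<close> gc by (simp add: Y_def)
  qed
  moreover have "finite Y" using fin by (rule rev_finite_subset) (auto simp: Y_def crossing_def)
  \<comment> \<open>Positive powers of g lie in \<open>A\<close> and \<one> does not, so g has
    infinite order.\<close>
  moreover have "inj_on (\<lambda>j. inv (g [^] j)) {..<N}"
  proof (rule linorder_inj_onI)
    fix i j :: nat assume "i < j"
    show "inv (g [^] i) \<noteq> inv (g [^] j)"
    proof
      assume "inv (g [^] i) = inv (g [^] j)"
      then have "g [^] i = g [^] j" using gc by (metis inv_inv nat_pow_closed)
      moreover have "g [^] i \<otimes> g [^] (j - i) = g [^] j" using gc \<open>i < j\<close> by (simp add: nat_pow_mult)
      ultimately have "g [^] i \<otimes> g [^] (j - i) = g [^] i \<otimes> \<one>" using gc by simp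
      then have "g [^] (j - i) = \<one>" using gc by simp
      then show False using pow[of "j - i"] one \<open>i < j\<close> by simp
    qed
  qed auto
  ultimately show False using card_inj_on_le[of "\<lambda>j. inv (g [^] j)" "{..<N}" Y] by simp
qed

end

section \<open>Components of ball complements\<close>

context cayley
begin

text \<open>Balls can then be studied by induction on relation powers. The assumption on
  \<open>u\<close> covers the empty walk, whose end must be a vertex.\<close>

lemma awalk_iff_relpow:
  assumes "u \<in> carrier G"
  shows "(\<exists>p. pre_digraph.awalk (with_proj (cayley_graph G T)) u p v \<and> length p = k) \<longleftrightarrow>
    (u, v) \<in> edges ^^ k"
  using assms
proof (induction k arbitrary: u)
  case 0
  then show ?case
    by (auto simp: pre_digraph.awalk_def pre_digraph.cas.simps cayley_graph_def)
next
  case (Suc k)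
  let ?walk = "pre_digraph.awalk (with_proj (cayley_graph G T))"
  have "(\<exists>p. ?walk u p v \<and> length p = Suc k) \<longleftrightarrow> (\<exists>w p. (u, w) \<in> edges \<and> ?walk w p v \<and> length p = k)"
  proof
    assume "\<exists>p. ?walk u p v \<and> length p = Suc k"
    then obtain e p where p: "?walk u (e # p) v" "length p = k" by (auto simp: length_Suc_conv)
    then have "(u, snd e) \<in> edges" "?walk (snd e) p v"
      using edges_carrier[of u "snd e"]
      by (auto simp: pre_digraph.awalk_def pre_digraph.cas.simps) (auto simp: cayley_graph_def)
    then show "\<exists>w p. (u, w) \<in> edges \<and> ?walk w p v \<and> length p = k" using p by blast
  next
    assume "\<exists>w p. (u, w) \<in> edges \<and> ?walk w p v \<and> length p = k"
    then obtain w p where p: "(u, w) \<in> edges" "?walk w p v" "length p = k" by blast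
    then have "?walk u ((u, w) # p) v"
      using Suc.prems by (auto simp: pre_digraph.awalk_def pre_digraph.cas.simps) (auto simp: cayley_graph_def)
    then show "\<exists>p. ?walk u p v \<and> length p = Suc k" using p by (metis length_Cons)
  qed
  also have "\<dots> \<longleftrightarrow> (\<exists>w. (u, w) \<in> edges \<and> (w, v) \<in> edges ^^ k)"
  proof (rule ex_cong1)
    fix w
    show "(\<exists>p. (u, w) \<in> edges \<and> ?walk w p v \<and> length p = k) \<longleftrightarrow> (u, w) \<in> edges \<and> (w, v) \<in> edges ^^ k"
      using Suc.IH[of w] edges_carrier[of u w] by (cases "(u, w) \<in> edges") simp_all
  qed
  also have "\<dots> \<longleftrightarrow> (u, v) \<in> edges ^^ Suc k"
    using relpow_Suc_I2 relpow_Suc_E2 by metis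
  finally show ?case .
qed

lemma cayley_ball_eq: "cayley_ball G T n = {g. \<exists>k\<le>n. (\<one>, g) \<in> edges ^^ k}"
  unfolding cayley_ball_def
proof (rule Collect_cong)
  fix g
  let ?walk = "pre_digraph.awalk (with_proj (cayley_graph G T)) \<one>"
  have "(\<exists>p. ?walk p g \<and> length p \<le> n) \<longleftrightarrow> (\<exists>k\<le>n. \<exists>p. ?walk p g \<and> length p = k)"
    by auto
  then show "(\<exists>p. ?walk p g \<and> length p \<le> n) \<longleftrightarrow> (\<exists>k\<le>n. (\<one>, g) \<in> edges ^^ k)"
    unfolding awalk_iff_relpow[OF one_closed] .
qed

lemma finite_cayley_ball: "finite (cayley_ball G T n)"
proof -
  have "finite {g. (\<one>, g) \<in> edges ^^ k}" for k
  proof (induction k)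
    case 0
    then show ?case by simp
  next
    case (Suc k)
    have "{g. (\<one>, g) \<in> edges ^^ Suc k} = edges `` {g. (\<one>, g) \<in> edges ^^ k}" by auto
    then show ?case using finite_neighbours[OF Suc] by simp
  qed
  then have "finite (\<Union>k\<in>{..n}. {g. (\<one>, g) \<in> edges ^^ k})" by blast
  then show ?thesis by (rule rev_finite_subset) (auto simp: cayley_ball_eq)
qed

lemma cayley_ball_subset: "cayley_ball G T n \<subseteq> carrier G"
proof
  fix g assume "g \<in> cayley_ball G T n"
  then obtain k where "(\<one>, g) \<in> edges ^^ k" by (auto simp: cayley_ball_eq)
  then show "g \<in> carrier G" using edges_carrier by (cases k) auto
qed

lemma one_in_cayley_ball: "\<one> \<in> cayley_ball G T n"
proof -
  have "(\<one>, \<one>) \<in> edges ^^ 0" by simp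
  then show ?thesis unfolding cayley_ball_eq by (intro CollectI exI[of _ 0]) simp
qed

text \<open>Every initial segment of a path of length at most \<open>n\<close> from \<one> ends in
  the ball.\<close>

lemma cayley_ball_connected:
  assumes "y \<in> cayley_ball G T n"
  shows "(\<one>, y) \<in> (edges \<inter> cayley_ball G T n \<times> cayley_ball G T n)\<^sup>*"
proof -
  let ?B = "cayley_ball G T n"
  have "(\<one>, y) \<in> edges ^^ k \<Longrightarrow> k \<le> n \<Longrightarrow> (\<one>, y) \<in> (edges \<inter> ?B \<times> ?B)\<^sup>*" for k
  proof (induction k arbitrary: y)
    case 0
    then show ?case by simp
  next
    case (Suc k)
    then obtain x where x: "(\<one>, x) \<in> edges ^^ k" "(x, y) \<in> edges" by auto
    moreover have "x \<in> ?B" using x(1) Suc.prems(2) by (auto simp: cayley_ball_eq intro!: exI[of _ k])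
    moreover have "y \<in> ?B" using Suc.prems by (auto simp: cayley_ball_eq intro!: exI[of _ "Suc k"])
    ultimately show ?case using Suc.IH[OF x(1)] Suc.prems(2)
      by (auto intro: rtrancl.rtrancl_into_rtrancl)
  qed
  then show ?thesis using assms by (auto simp: cayley_ball_eq)
qed

lemma finite_subset_cayley_ball:
  assumes "finite F" "F \<subseteq> carrier G"
  shows "\<exists>m. F \<subseteq> cayley_ball G T m"
  using assms
proof induction
  case empty
  then show ?case by simp
next
  case (insert x F)
  then obtain m where "F \<subseteq> cayley_ball G T m" by blast
  moreover obtain k where "(\<one>, x) \<in> edges ^^ k"
    using edges_connected insert.prems rtrancl_imp_relpow by blast
  ultimately have "insert x F \<subseteq> cayley_ball G T (max m k)"
    unfolding cayley_ball_eq by (auto simp: le_max_iff_disj)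
  then show ?case by blast
qed

text \<open>Balls are finite, and each finite set of group elements lies in some ball.\<close>

lemma cayley_unbounded_iff:
  assumes "C \<subseteq> carrier G"
  shows "cayley_unbounded G T C \<longleftrightarrow> infinite C"
proof
  show "infinite C" if "cayley_unbounded G T C"
    using that finite_subset_cayley_ball[OF _ assms] by (auto simp: cayley_unbounded_def)
  show "cayley_unbounded G T C" if "infinite C"
    using that finite_subset[OF _ finite_cayley_ball] by (auto simp: cayley_unbounded_def)
qed

abbreviation ball_complement :: "nat \<Rightarrow> ('a, 'a \<times> 'a) pre_digraph" where
  "ball_complement n \<equiv> with_proj (cayley_graph G T) \<restriction> (carrier G - cayley_ball G T n)"

lemma dominates_ball_complement:
  "u \<rightarrow>\<^bsub>ball_complement n\<^esub> v \<longleftrightarrow> (u, v) \<in> edges \<and> u \<notin> cayley_ball G T n \<and> v \<notin> cayley_ball G T n"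
proof -
  have "u \<rightarrow>\<^bsub>ball_complement n\<^esub> v \<longleftrightarrow>
      (u, v) \<in> edges \<and> u \<in> carrier G - cayley_ball G T n \<and> v \<in> carrier G - cayley_ball G T n"
    by (auto simp: arcs_ends_def arc_to_ends_def image_iff)
  then show ?thesis using edges_carrier[of u v] by blast
qed

lemma sym_digraph_ball_complement: "sym_digraph (ball_complement n)"
proof
  show "symmetric (ball_complement n)"
    unfolding symmetric_def by (rule symI) (simp add: dominates_ball_complement edges_sym)
qed auto

text \<open>The ball plays the role of \<open>K\<close>. Reachability is symmetric here, so an edge
  that stays outside the ball stays in one strong component.\<close>

lemma component_cayley_side:
  assumes C: "C \<in> ball_complement_components G T n"
  shows "cayley_side G T (cayley_ball G T n) C"
proof (intro cayley_side.intro cayley_side_axioms.intro)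
  interpret H: sym_digraph "ball_complement n" by (rule sym_digraph_ball_complement)
  have C': "C \<in> H.sccs_verts" using C by (simp add: ball_complement_components_def)
  show sub: "C \<subseteq> carrier G - cayley_ball G T n"
    using H.sccs_verts_subsets[OF C'] by simp
  show "cayley G T" by (rule cayley_axioms)
  show "finite (cayley_ball G T n)" by (rule finite_cayley_ball)
  show "cayley_ball G T n \<subseteq> carrier G" by (rule cayley_ball_subset)
  show "\<one> \<in> cayley_ball G T n" by (rule one_in_cayley_ball)
  show "(\<one>, y) \<in> (edges \<inter> cayley_ball G T n \<times> cayley_ball G T n)\<^sup>*"
    if "y \<in> cayley_ball G T n" for y
    using that by (rule cayley_ball_connected)
  fix u v assume uv: "u \<in> C" "(u, v) \<in> edges" "v \<notin> cayley_ball G T n"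
  then have "u \<rightarrow>\<^bsub>ball_complement n\<^esub> v" using sub by (auto simp: dominates_ball_complement)
  then have "u \<rightarrow>\<^sup>*\<^bsub>ball_complement n\<^esub> v" by blast
  moreover then have "v \<rightarrow>\<^sup>*\<^bsub>ball_complement n\<^esub> u" by (rule H.symmetric_reachable')
  ultimately have "v \<in> H.scc_of u" by (simp add: H.scc_of_def)
  moreover have "H.scc_of u \<in> H.sccs_verts" "u \<in> H.scc_of u"
    using uv(1) sub by (auto intro!: H.scc_of_in_sccs_verts H.in_scc_of_self)
  moreover then have "H.scc_of u = C" using H.sccs_verts_disjoint[OF _ C'] uv(1) by auto
  ultimately show "v \<in> C" by simp
qed

lemma components_disjoint:
  assumes "C \<in> ball_complement_components G T n" "D \<in> ball_complement_components G T n" "C \<noteq> D"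
  shows "C \<inter> D = {}"
proof -
  interpret H: sym_digraph "ball_complement n" by (rule sym_digraph_ball_complement)
  show ?thesis
    using assms unfolding ball_complement_components_def by (rule H.sccs_verts_disjoint)
qed

text \<open>Every component contains a neighbour of the ball, of which there are finitely many.\<close>

lemma ex_infinite_component:
  assumes "infinite (carrier G)"
  shows "\<exists>C. C \<in> ball_complement_components G T n \<and> infinite C"
proof (rule ccontr)
  interpret H: sym_digraph "ball_complement n" by (rule sym_digraph_ball_complement)
  let ?B = "cayley_ball G T n"
  assume none: "\<nexists>C. C \<in> ball_complement_components G T n \<and> infinite C"
  have fin: "finite (H.scc_of w)" if "w \<in> carrier G - ?B" for w
  proof -
    have "H.scc_of w \<in> ball_complement_components G T n"
      unfolding ball_complement_components_def using that by (intro H.scc_of_in_sccs_verts) simp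
    then show ?thesis using none by blast
  qed
  \<comment> \<open>The witness is the last vertex before a path from \<open>u\<close> to \<one>
    first enters the ball.\<close>
  have near: "\<exists>w \<in> edges `` ?B - ?B. u \<rightarrow>\<^sup>*\<^bsub>ball_complement n\<^esub> w" if "u \<in> carrier G - ?B" for u
  proof -
    have "(u, \<one>) \<in> edges\<^sup>*" using that edges_connected' by blast
    then show ?thesis using that
    proof (induction rule: converse_rtrancl_induct)
      case base
      then show ?case using one_in_cayley_ball by blast
    next
      case (step u v)
      show ?case
      proof (cases "v \<in> ?B")
        case True
        then have "u \<in> edges `` ?B - ?B" using edges_sym step by blast
        moreover have "u \<rightarrow>\<^sup>*\<^bsub>ball_complement n\<^esub> u" using step.prems by simp
        ultimately show ?thesis by blast
      next
        case False
        then have "v \<in> carrier G - ?B" using edges_carrier step by blast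
        moreover have "u \<rightarrow>\<^bsub>ball_complement n\<^esub> v"
          using step False by (simp add: dominates_ball_complement)
        ultimately show ?thesis using step.IH H.adj_reachable_trans by blast
      qed
    qed
  qed
  have "carrier G - ?B \<subseteq> (\<Union>w\<in>edges `` ?B - ?B. H.scc_of w)"
    using near H.scc_ofI_reachable by blast
  moreover have "finite (\<Union>w\<in>edges `` ?B - ?B. H.scc_of w)"
    using finite_neighbours[OF finite_cayley_ball] fin edges_carrier by blast
  ultimately have "finite (carrier G - ?B)" by (rule finite_subset)
  then show False using assms finite_cayley_ball by simp
qed

lemma one_ended_if_limits:
  assumes S: "generating_set G S" and s: "s \<in> S" "ord s = 0"
    and lim: "\<And>A. almost_invariant A \<Longrightarrow> \<exists>c. \<forall>x\<in>carrier G. \<forall>r\<in>S. limit_along A x r c"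
  shows "one_ended G"
proof -
  have sc: "s \<in> carrier G" "ord s = 0" using s S by (auto simp: generating_set_def)
  have "infinite (range (\<lambda>k::int. s [^] k))"
    using finite_imageD[OF _ inj_int_pow[OF sc]] infinite_UNIV_int by blast
  then have inf: "infinite (carrier G)"
    using sc by (meson finite_subset image_subsetI int_pow_closed)
  have cofin: "limit_along C \<one> s True"
    if C: "C \<in> ball_complement_components G T m" "infinite C" for C m
  proof -
    interpret side: cayley_side G T "cayley_ball G T m" C
      by (rule component_cayley_side[OF C(1)])
    obtain c where c: "\<forall>x\<in>carrier G. \<forall>r\<in>S. limit_along C x r c"
      using lim[OF side.almost_invariant] by blast
    \<comment> \<open>The limit value False would make the component finite by
      \<open>finite_A\<close>.\<close>
    have "c"
    proof (rule ccontr)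
      assume "\<not> c"
      then have "finite C" using side.finite_A[OF S] s c by auto
      then show False using C(2) by blast
    qed
    then show ?thesis using c s by auto
  qed
  have "\<exists>!C. C \<in> ball_complement_components G T m \<and> cayley_unbounded G T C" for m
  proof -
    have unb: "cayley_unbounded G T C \<longleftrightarrow> infinite C" if "C \<in> ball_complement_components G T m" for C
    proof -
      interpret side: cayley_side G T "cayley_ball G T m" C
        by (rule component_cayley_side[OF that])
      show ?thesis using side.A_subset by (intro cayley_unbounded_iff) blast
    qed
    have "C = D" if "C \<in> ball_complement_components G T m" "infinite C"
      "D \<in> ball_complement_components G T m" "infinite D" for C D
    proof (rule ccontr)
      assume "C \<noteq> D"
      then have "C \<inter> D = {}" using that components_disjoint by blast
      \<comment> \<open>Every power of \<open>s\<close> misses \<open>C\<close> or \<open>D\<close>,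
        yet each of them misses only finitely many.\<close>
      then have "(UNIV :: int set) = {k. (\<one> \<otimes> s [^] k \<in> C) \<noteq> True} \<union> {k. (\<one> \<otimes> s [^] k \<in> D) \<noteq> True}"
        by auto
      moreover have "finite {k::int. (\<one> \<otimes> s [^] k \<in> C) \<noteq> True}" "finite {k::int. (\<one> \<otimes> s [^] k \<in> D) \<noteq> True}"
        using cofin that unfolding limit_along_def by blast+
      ultimately show False using infinite_UNIV_int by (metis finite_UnI)
    qed
    then show ?thesis using ex_infinite_component[OF inf, of m] unb by metis
  qed
  then show ?thesis using inf finite_T generating_T unfolding one_ended_def by blast
qed

end

theorem theorem9:
  fixes G :: "('a, 'b) monoid_scheme" and S :: "'a set"
    and s s' :: 'a and n n' :: int
  assumes "group G"
    and "finitely_generated G"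
    and "\<not> virtually_Z G"
    and "generating_set G S"
    and "\<exists>x\<in>S. \<exists>y\<in>S. x \<noteq> y"
    and "\<forall>x\<in>S. group.ord G x = 0"
    and "Digraph_Component.connected (with_proj (commutativity_graph G S))"
    and "s \<rightarrow>\<^bsub>with_proj (commutativity_graph G S)\<^esub> s'"
    and "n \<noteq> 0" and "n' \<noteq> 0"
    and "comm_group (subgroup_generated G {s [^]\<^bsub>G\<^esub> n, s' [^]\<^bsub>G\<^esub> n'})"
    and "has_rank (subgroup_generated G {s [^]\<^bsub>G\<^esub> n, s' [^]\<^bsub>G\<^esub> n'}) 2"
  shows "one_ended G"
proof -
  obtain T where T: "finite T" "generating_set G T"
    using assms(2) by (auto simp: finitely_generated_def)
  interpret cayley G T
    by (intro cayley.intro cayley_axioms.intro assms(1) T)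
  have S: "S \<subseteq> carrier G" using assms(4) by (simp add: generating_set_def)
  have s: "s \<in> S" "s' \<in> S" using assms(8) by (auto simp: commutativity_graph_def)
  show ?thesis
  proof (rule one_ended_if_limits[OF assms(4) s(1)])
    show "ord s = 0" using assms(6) s(1) by blast
    show "\<exists>c. \<forall>x\<in>carrier G. \<forall>r\<in>S. limit_along A x r c" if "almost_invariant A" for A
      by (rule limit_along_independent_of_base[OF assms(4)])
        (rule limit_along_generating_set[OF that _ S assms(6,7) s assms(9-12)])
  qed
qed

end
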